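(* Let $k\ge 0$ be an integer. Every graph $G$ with treewidth at most $k$ has a slick tree-decomposition with width at most $14k+13$ and degree at most $6$.
   Context: Graphs are simple, undirected and finite. For a non-empty tree $T$, a $T$-decomposition of a graph $G$ is a collection $(B_x:x\in V(T))$ of subsets $B_x\subseteq V(G)$ such that for each edge $vw\in E(G)$ some bag contains both $v$ and $w$, and for each $v\in V(G)$ the set $\{x\in V(T):v\in B_x\}$ induces a non-empty connected subtree of $T$. Its width is $\max_x|B_x|-1$ and its degree is the maximum degree of $T$; treewidth is the minimum width of a tree-decomposition. A tree-decomposition is rooted if $T$ is rooted. A rooted tree-decomposition $(B_x:x\in V(T))$ is slick if for each edge $xy\in E(T)$ with $x$ the parent of $y$, and each vertex $v\in B_x\cap B_y$, we have $(N_G(v)\cap B_y)\setminus B_x\neq\emptyset$. *)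

theory Defs
  imports "Graph_Theory.Graph_Theory"
begin

text \<open>
  A finite simple undirected graph is a \<^locale>\<open>pair_graph\<close>: an edge \<open>vw\<close> is the
  pair of arcs \<open>(v, w)\<close>, \<open>(w, v)\<close>.
\<close>

definition nbhd :: "'a pair_pre_digraph \<Rightarrow> 'a \<Rightarrow> 'a set" where
  "nbhd G v = {w. (v, w) \<in> parcs G}"

definition max_degree :: "'a pair_pre_digraph \<Rightarrow> nat" where
  "max_degree G = Max ((\<lambda>v. card (nbhd G v)) ` pverts G)"

text \<open>
  In the symmetric digraph representing an undirected graph, the closed walk
  \<open>a, b, a\<close> satisfies \<^const>\<open>pre_digraph.cycle\<close>, so \<^const>\<open>Digraph_Component.tree\<close> is
  not the undirected notion; cycles of an undirected graph are those of length at
  least 3. Non-emptiness is part of \<^const>\<open>Digraph_Component.connected\<close>.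
\<close>

definition undirected_tree :: "'a pair_pre_digraph \<Rightarrow> bool" where
  "undirected_tree T \<longleftrightarrow>
     pair_graph T \<and> Digraph_Component.connected (with_proj T) \<and>
     \<not> (\<exists>p. pre_digraph.cycle (with_proj T) p \<and> 3 \<le> length p)"

definition tree_decomposition ::
  "'a pair_pre_digraph \<Rightarrow> 't pair_pre_digraph \<Rightarrow> ('t \<Rightarrow> 'a set) \<Rightarrow> bool" where
  "tree_decomposition G T B \<longleftrightarrow>
     undirected_tree T \<and>
     (\<forall>x\<in>pverts T. B x \<subseteq> pverts G) \<and>
     (\<forall>(v, w)\<in>parcs G. \<exists>x\<in>pverts T. v \<in> B x \<and> w \<in> B x) \<and>
     (\<forall>v\<in>pverts G.
        Digraph_Component.connected (induce_subgraph (with_proj T) {x \<in> pverts T. v \<in> B x}))"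

text \<open>Integer-valued, since the null graph has a decomposition of width \<open>-1\<close>.\<close>

definition decomposition_width :: "'t pair_pre_digraph \<Rightarrow> ('t \<Rightarrow> 'a set) \<Rightarrow> int" where
  "decomposition_width T B = int (Max ((\<lambda>x. card (B x)) ` pverts T)) - 1"

text \<open>
  Every finite tree is isomorphic to one whose nodes are natural numbers, so
  restricting the minimum to node type \<^typ>\<open>nat\<close> loses nothing.
\<close>

definition treewidth :: "'a pair_pre_digraph \<Rightarrow> int" where
  "treewidth G =
     (LEAST w. \<exists>(T :: nat pair_pre_digraph) B.
        tree_decomposition G T B \<and> decomposition_width T B = w)"

text \<open>\<open>x\<close> is the neighbour of \<open>y\<close> on the path of \<open>T\<close> from the root \<open>r\<close> to \<open>y\<close>.\<close>

definition parent_of :: "'t pair_pre_digraph \<Rightarrow> 't \<Rightarrow> 't \<Rightarrow> 't \<Rightarrow> bool" where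
  "parent_of T r x y \<longleftrightarrow>
     (x, y) \<in> parcs T \<and>
     (\<exists>p. vpath p (with_proj T) \<and> hd p = r \<and> last p = y \<and> x \<in> set p)"

definition rooted_tree_decomposition ::
  "'a pair_pre_digraph \<Rightarrow> 't pair_pre_digraph \<Rightarrow> 't \<Rightarrow> ('t \<Rightarrow> 'a set) \<Rightarrow> bool" where
  "rooted_tree_decomposition G T r B \<longleftrightarrow> tree_decomposition G T B \<and> r \<in> pverts T"

definition slick ::
  "'a pair_pre_digraph \<Rightarrow> 't pair_pre_digraph \<Rightarrow> 't \<Rightarrow> ('t \<Rightarrow> 'a set) \<Rightarrow> bool" where
  "slick G T r B \<longleftrightarrow>
     (\<forall>x y. parent_of T r x y \<longrightarrow>
        (\<forall>v \<in> B x \<inter> B y. (nbhd G v \<inter> B y) - B x \<noteq> {}))"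

text \<open>
  The minimum in \<^const>\<open>treewidth\<close> exists: the set of widths is bounded below and
  contains the width of the decomposition with a single bag.
\<close>

lemma tree_decomposition_single_bag:
  fixes G :: "'a pair_pre_digraph" and x :: 't
  assumes "pair_graph G"
  shows "tree_decomposition G \<lparr>pverts = {x}, parcs = {}\<rparr> (\<lambda>_. pverts G)"
proof -
  interpret pair_graph G by fact
  let ?T = "\<lparr>pverts = {x}, parcs = {}\<rparr>"
  have conn: "Digraph_Component.connected H" if "verts H = {x}" for H :: "('t, 't \<times> 't) pre_digraph"
    using that
    by (auto simp: Digraph_Component.connected_def strongly_connected_def mk_symmetric_def
        reachable_def)
  have "pair_graph ?T"
    by unfold_locales (auto simp: symmetric_def sym_def)
  moreover have "\<not> pre_digraph.cycle (with_proj ?T) p" for p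
    by (auto simp: pre_digraph.cycle_def pre_digraph.awalk_def)
  ultimately have "undirected_tree ?T"
    unfolding undirected_tree_def using conn by auto
  then show ?thesis
    unfolding tree_decomposition_def
    by (auto intro!: conn dest: in_arcsD1 in_arcsD2)
qed

lemma treewidth_attained:
  assumes "pair_graph G"
  obtains T :: "nat pair_pre_digraph" and B
  where "tree_decomposition G T B" "decomposition_width T B = treewidth G"
proof -
  let ?P = "\<lambda>w. \<exists>(T :: nat pair_pre_digraph) B.
    tree_decomposition G T B \<and> decomposition_width T B = w"
  let ?Q = "\<lambda>n. ?P (int n - 1)"
  have P_nat: "\<exists>n. w = int n - 1" if "?P w" for w
    using that by (auto simp: decomposition_width_def)
  obtain T :: "nat pair_pre_digraph" and B where "tree_decomposition G T B"
    using tree_decomposition_single_bag[OF assms] by metis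
  then have "?P (decomposition_width T B)" by (intro exI conjI) (assumption, rule refl)
  with P_nat[OF this] have "\<exists>n. ?Q n" by metis
  then have Q: "?Q (LEAST n. ?Q n)" by (rule LeastI_ex)
  have "(LEAST w. ?P w) = int (LEAST n. ?Q n) - 1"
  proof (rule Least_equality)
    show "?P (int (LEAST n. ?Q n) - 1)" by (rule Q)
  next
    fix w assume w: "?P w"
    then obtain n where n: "w = int n - 1" using P_nat[OF w] by auto
    with w have "?Q n" by simp
    then have "(LEAST n. ?Q n) \<le> n" by (rule Least_le)
    with n show "int (LEAST n. ?Q n) - 1 \<le> w" by simp
  qed
  with Q have "?P (treewidth G)" unfolding treewidth_def by simp
  then show ?thesis by (elim exE conjE) (rule that)
qed

end

theory Submission
  imports Defs "HOL-Library.Countable"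
begin

text \<open>
  Let \<open>K = k + 1\<close> and fix a tree-decomposition of \<open>G\<close> with bags of size at most \<open>K\<close>.
  By induction on \<open>card (V - S)\<close>, every \<open>G[V]\<close> with a set \<open>S \<subseteq> V\<close> of size at most \<open>12K\<close> has a
  slick decomposition with bags of size at most \<open>14K\<close>, at most five children per node, and
  \<open>S\<close> inside the root bag. Cutting the given tree at two nodes yields a set \<open>X\<close> of size at
  most \<open>2K\<close> such that every component of \<open>G[V] - X\<close> has at most \<open>4K\<close> vertices of \<open>S\<close>.
  Merging components as long as their union has at most \<open>4K\<close> vertices of \<open>S\<close> leaves at most five
  groups, since six groups would form three pairs with more than \<open>4K\<close> such vertices each.
  The root bag is \<open>S \<union> X\<close>. At most \<open>4K + 2K\<close> of its vertices have a neighbour among the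
  vertices of a given group outside the root bag; these vertices, together with one such
  neighbour each, form a set of size at most \<open>12K\<close> that is handed to the recursive call for
  that group. The chosen neighbours make the new arc slick, and they make the induction
  parameter decrease.
\<close>

section \<open>Undirected trees and bridges\<close>

text \<open>The arcs are symmetric already, so the symmetrisation inside \<open>connected\<close>
  adds nothing. Connectivity becomes a statement about a reflexive transitive closure, and the tree
  arguments can run on plain relations.\<close>

lemma connected_induce_iff:
  assumes "pair_graph T"
  shows "Digraph_Component.connected (induce_subgraph (with_proj T) U) \<longleftrightarrow>
    U \<noteq> {} \<and> (\<forall>x\<in>U. \<forall>y\<in>U. (x, y) \<in> (Restr (parcs T) U)\<^sup>*)"
proof -
  interpret pair_graph T by fact
  have parcs: "parcs (mk_symmetric (induce_subgraph (with_proj T) U)) = Restr (parcs T) U"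
    by (auto simp: mk_symmetric_def arcs_symmetric)
  have verts: "pverts (mk_symmetric (induce_subgraph (with_proj T) U)) = U"
    by (simp add: mk_symmetric_def)
  have "(x, y) \<in> rtrancl_on U (Restr (parcs T) U) \<longleftrightarrow> (x, y) \<in> (Restr (parcs T) U)\<^sup>*"
    if "x \<in> U" "y \<in> U" for x y
    using that by (auto intro: rtrancl_on_rtranclI rtrancl_consistent_rtrancl_on)
  then show ?thesis
    by (simp add: Digraph_Component.connected_def strongly_connected_def reachable_def parcs verts)
qed

lemma connected_iff:
  assumes "pair_graph T"
  shows "Digraph_Component.connected (with_proj T) \<longleftrightarrow>
    pverts T \<noteq> {} \<and> (\<forall>x\<in>pverts T. \<forall>y\<in>pverts T. (x, y) \<in> (parcs T)\<^sup>*)"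
proof -
  interpret pair_graph T by fact
  have "induce_subgraph (with_proj T) (pverts T) = with_proj T"
    by (auto simp: induce_subgraph_def with_proj_def dest: in_arcsD1 in_arcsD2)
  moreover have "Restr (parcs T) (pverts T) = parcs T"
    by (auto dest: in_arcsD1 in_arcsD2)
  ultimately show ?thesis
    using connected_induce_iff[OF assms, of "pverts T"] by simp
qed

lemma (in pair_wf_digraph) awalk_imp_rtrancl:
  assumes "awalk u p v" "set p \<subseteq> F"
  shows "(u, v) \<in> F\<^sup>*"
  using assms
proof (induction p arbitrary: u)
  case (Cons e p)
  then have "(u, snd e) \<in> F" "(snd e, v) \<in> F\<^sup>*"
    by (auto simp: awalk_simps)
  then show ?case by (rule converse_rtrancl_into_rtrancl)
qed (simp add: awalk_simps)

lemma (in pair_wf_digraph) rtrancl_imp_awalk: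
  assumes "(u, v) \<in> F\<^sup>*" "F \<subseteq> parcs G" "v \<in> pverts G"
  obtains p where "awalk u p v" "set p \<subseteq> F"
proof -
  from assms(1) have "\<exists>p. awalk u p v \<and> set p \<subseteq> F"
  proof (induction rule: converse_rtrancl_induct)
    case base
    then show ?case using assms(3) by (intro exI[of _ "[]"]) (auto simp: awalk_simps)
  next
    case (step u w)
    then obtain p where "awalk w p v" "set p \<subseteq> F" by blast
    with step.hyps(1) assms(2) show ?case
      by (intro exI[of _ "(u, w) # p"]) (auto simp: awalk_simps dest: in_arcsD1)
  qed
  with that show ?thesis by blast
qed

lemma (in pair_graph) awalk_avoids_vertex:
  assumes "awalk u p v" "x \<notin> set (pawalk_verts u p)" "e \<in> set p"
  shows "fst e \<noteq> x" "snd e \<noteq> x"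
  using assms by (induction p arbitrary: u) (auto simp: awalk_simps hd_in_awalk_verts)

text \<open>Removing an arc from a cycle of length at least 3 leaves a detour around that arc, and a
  detour shortened to a path closes up with the arc to such a cycle. Bridges serve both for cutting
  the given tree and for verifying the constructed one.\<close>

lemma undirected_tree_iff_bridges:
  "undirected_tree T \<longleftrightarrow>
     pair_graph T \<and> Digraph_Component.connected (with_proj T) \<and>
     (\<forall>x y. (x, y) \<in> parcs T \<longrightarrow> (x, y) \<notin> (parcs T - {(x, y), (y, x)})\<^sup>*)"
proof (cases "pair_graph T")
  case True
  then interpret pair_graph T .
  have "(\<exists>p. cycle p \<and> 3 \<le> length p) \<longleftrightarrow>
      (\<exists>x y. (x, y) \<in> parcs T \<and> (x, y) \<in> (parcs T - {(x, y), (y, x)})\<^sup>*)" (is "?cyc \<longleftrightarrow> ?br")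
  proof
    assume ?cyc
    then obtain u p where p: "awalk u p u" "distinct (tl (pawalk_verts u p))" "3 \<le> length p"
      unfolding cycle_def by auto
    \<comment> \<open>Length at least 3 makes \<open>q\<close> nonempty. A nonempty path is not
      closed, which gives \<open>z \<noteq> u\<close> and keeps the arc \<open>(w, z)\<close> apart
      from \<open>(w, u)\<close>.\<close>
    from p(3) obtain e f q where pe: "p = e # f # q" "q \<noteq> []"
      by (auto simp: numeral_3_eq_3 Suc_le_length_iff)
    define w z where "w = snd e" and "z = snd f"
    have "p = (u, w) # (w, z) # q"
      using p(1) by (simp add: pe w_def z_def awalk_simps prod_eq_iff)
    with p pe(2) have uw: "(u, w) \<in> parcs T" and wz: "(w, z) \<in> parcs T"
      and q: "awalk z q u" "distinct (w # pawalk_verts z q)"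
      by (auto simp: awalk_simps)
    have "set q \<subseteq> parcs T - {(u, w), (w, u)}"
      using q awalk_avoids_vertex[OF q(1), of w] by (fastforce simp: awalk_def)
    moreover have "z \<noteq> u"
    proof
      assume "z = u"
      with q pe(2) show False
        using apath_nonempty_ends[of z q u] by (auto simp: apath_def)
    qed
    moreover have "w \<noteq> u" using uw no_loops' by blast
    ultimately have "set ((w, z) # q) \<subseteq> parcs T - {(w, u), (u, w)}"
      using wz by auto
    moreover have "awalk w ((w, z) # q) u"
      using q wz by (auto simp: awalk_simps)
    ultimately have "(w, u) \<in> (parcs T - {(w, u), (u, w)})\<^sup>*"
      by (rule awalk_imp_rtrancl[rotated])
    with uw arcs_symmetric show ?br by blast
  next
    assume ?br
    then obtain x y where xy: "(x, y) \<in> parcs T"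
      and r: "(x, y) \<in> (parcs T - {(x, y), (y, x)})\<^sup>*"
      by blast
    obtain p' where p': "awalk x p' y" "set p' \<subseteq> parcs T - {(x, y), (y, x)}"
      using rtrancl_imp_awalk[OF r] in_arcsD2[OF xy] by blast
    define p where "p = awalk_to_apath p'"
    have p: "apath x p y" "set p \<subseteq> parcs T - {(x, y), (y, x)}"
      using apath_awalk_to_apath[OF p'(1)] awalk_to_apath_subset[OF p'(1)] p'(2)
      unfolding p_def by blast+
    have "x \<noteq> y" using xy no_loops' by blast
    \<comment> \<open>A path of a single arc would be the deleted arc \<open>(x, y)\<close>
      itself.\<close>
    with p have "p \<noteq> []" "\<And>e. p \<noteq> [e]"
      by (auto simp: apath_simps)
    then have "2 \<le> length p"
      by (cases p; cases "tl p") auto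
    moreover have "cycle ((y, x) # p)"
      unfolding cycle_def using p xy arcs_symmetric in_arcsD2
      by (auto simp: apath_def awalk_simps intro!: exI[of _ y])
    ultimately show ?cyc by (intro exI[of _ "(y, x) # p"]) auto
  qed
  then show ?thesis
    unfolding undirected_tree_def using True by blast
qed (auto simp: undirected_tree_def)

section \<open>Balanced separators\<close>

definition del :: "'t rel \<Rightarrow> 't \<Rightarrow> 't rel" where
  "del A a = Restr A (- {a})"

text \<open>Relational form of a tree-decomposition with bags of size at most \<open>K\<close>: a
  tree is a connected symmetric relation in which every arc is a bridge.\<close>

locale abstract_tree_decomposition =
  fixes N :: "'t set" and A :: "'t rel" and B :: "'t \<Rightarrow> 'a set"
    and V :: "'a set" and E :: "'a rel" and K :: nat
  assumes finite_nodes: "finite N" and nodes_nonempty: "N \<noteq> {}"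
    and arcs_subset: "A \<subseteq> N \<times> N" and sym_arcs: "sym A"
    and connected_nodes: "x \<in> N \<Longrightarrow> y \<in> N \<Longrightarrow> (x, y) \<in> A\<^sup>*"
    and bridge: "(x, y) \<in> A \<Longrightarrow> (x, y) \<notin> (A - {(x, y), (y, x)})\<^sup>*"
    and bag_subset: "x \<in> N \<Longrightarrow> B x \<subseteq> V" and finite_bag: "x \<in> N \<Longrightarrow> finite (B x)"
    and card_bag: "x \<in> N \<Longrightarrow> card (B x) \<le> K"
    and bag_exists: "v \<in> V \<Longrightarrow> \<exists>x\<in>N. v \<in> B x"
    and bags_connected: "x \<in> N \<Longrightarrow> y \<in> N \<Longrightarrow> v \<in> B x \<Longrightarrow> v \<in> B y \<Longrightarrow>
      (x, y) \<in> (Restr A {x \<in> N. v \<in> B x})\<^sup>*"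
    and edge_in_bag: "(v, w) \<in> E \<Longrightarrow> \<exists>x\<in>N. v \<in> B x \<and> w \<in> B x"
begin

text \<open>The nodes that removing \<open>a\<close> cuts off from the root \<open>r\<close>; all of them if \<open>a = r\<close>.\<close>

definition desc :: "'t \<Rightarrow> 't \<Rightarrow> 't set" where
  "desc r a = {z \<in> N. z = a \<or> (r, z) \<notin> (del A a)\<^sup>*}"

lemma sym_del:
  assumes "(x, y) \<in> (del A a)\<^sup>*" shows "(y, x) \<in> (del A a)\<^sup>*"
proof -
  have "sym (del A a)" using sym_arcs by (auto simp: del_def sym_def)
  from symD[OF sym_rtrancl[OF this] assms] show ?thesis .
qed

text \<open>A component \<open>C\<close> of the tree without \<open>a\<close> is joined to
  \<open>a\<close> by a single arc \<open>(y, a)\<close>, since a second one would bypass the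
  bridge. If \<open>C\<close> misses the root, every walk from the root into \<open>C\<close> enters
  through \<open>y\<close>, so \<open>C\<close> lies below \<open>y\<close>, and \<open>y\<close>
  lies strictly below \<open>a\<close>.\<close>

lemma comp_subset_desc:
  assumes "r \<in> N" "a \<in> N" "z \<in> N" "z \<noteq> a" "(z, r) \<notin> (del A a)\<^sup>*"
  shows "\<exists>y\<in>N. (del A a)\<^sup>* `` {z} \<subseteq> desc r y \<and> desc r y \<subset> desc r a"
proof -
  define C where "C = (del A a)\<^sup>* `` {z}"
  have zC: "z \<in> C" and rC: "r \<notin> C"
    using assms by (auto simp: C_def)
  have C_step: "u' \<in> C" if "u \<in> C" "(u, u') \<in> A" "u' \<noteq> a" "u \<noteq> a" for u u'
  proof -
    have "(z, u) \<in> (del A a)\<^sup>*" "(u, u') \<in> del A a"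
      using that by (auto simp: C_def del_def)
    then have "(z, u') \<in> (del A a)\<^sup>*" by (rule rtrancl_into_rtrancl)
    then show ?thesis by (simp add: C_def)
  qed
  have aC: "a \<notin> C"
  proof
    assume "a \<in> C"
    then have "(z, a) \<in> (del A a)\<^sup>*" by (simp add: C_def)
    then show False
      by (rule rtranclE) (use \<open>z \<noteq> a\<close> in \<open>auto simp: del_def\<close>)
  qed
  have C_enter: "u = a" if "u \<notin> C" "u' \<in> C" "(u, u') \<in> A" for u u'
    using C_step[of u' u] that aC symD[OF sym_arcs that(3)] by auto
  have CN: "C \<subseteq> N"
  proof
    fix u assume "u \<in> C"
    then have "(z, u) \<in> (del A a)\<^sup>*" by (simp add: C_def)
    then show "u \<in> N"
      by (induction rule: rtrancl_induct) (use arcs_subset \<open>z \<in> N\<close> in \<open>auto simp: del_def\<close>)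
  qed
  have "(z, a) \<in> A\<^sup>*" using assms connected_nodes by blast
  then have "\<exists>y\<in>C. (y, a) \<in> A"
    using zC
  proof (induction rule: converse_rtrancl_induct)
    case base
    then show ?case using aC by simp
  next
    case (step u u')
    then show ?case using C_step[of u u'] aC by (cases "u' = a") auto
  qed
  then obtain y where y: "y \<in> C" "(y, a) \<in> A" by blast
  have only_y: "y' = y" if y': "y' \<in> C" "(y', a) \<in> A" for y'
  proof (rule ccontr)
    assume "y' \<noteq> y"
    have "(y, y') \<in> (del A a)\<^sup>*"
      using y(1) y'(1) rtrancl_trans[OF sym_del[of z y]] unfolding C_def by blast
    moreover have "del A a \<subseteq> A - {(y, a), (a, y)}" by (auto simp: del_def)
    ultimately have "(y, y') \<in> (A - {(y, a), (a, y)})\<^sup>*" using rtrancl_mono by blast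
    moreover have "(y', a) \<in> A - {(y, a), (a, y)}"
      using y' \<open>y' \<noteq> y\<close> aC by auto
    ultimately have "(y, a) \<in> (A - {(y, a), (a, y)})\<^sup>*" by (rule rtrancl_into_rtrancl)
    with bridge[OF y(2)] show False by contradiction
  qed
  have "C \<subseteq> desc r y"
  proof
    fix u assume "u \<in> C"
    \<comment> \<open>Entering \<open>C\<close> is possible only by the arc from \<open>a\<close> to
      \<open>y\<close>, so walks from \<open>r\<close> that avoid \<open>y\<close> stay
      outside.\<close>
    have "u' \<notin> C" if "(r, u') \<in> (del A y)\<^sup>*" for u'
      using that
    proof (induction rule: rtrancl_induct)
      case base
      show ?case by (rule rC)
    next
      case (step u u')
      show ?case
      proof
        assume "u' \<in> C"
        moreover have "(u, u') \<in> A" "u' \<noteq> y" using step by (auto simp: del_def)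
        ultimately show False
          using C_enter[of u u'] step.IH only_y[of u'] symD[OF sym_arcs, of u u'] by blast
      qed
    qed
    with \<open>u \<in> C\<close> CN show "u \<in> desc r y" by (auto simp: desc_def)
  qed
  moreover have "desc r y \<subset> desc r a"
  proof
    show "desc r y \<subseteq> desc r a"
    proof
      fix u assume u: "u \<in> desc r y"
      show "u \<in> desc r a"
      proof (rule ccontr)
        assume "u \<notin> desc r a"
        with u have ru: "(r, u) \<in> (del A a)\<^sup>*" by (auto simp: desc_def)
        \<comment> \<open>A walk from \<open>r\<close> avoiding \<open>a\<close> avoids
          \<open>y\<close> as well, because \<open>y\<close> would put \<open>r\<close> into
          \<open>C\<close>.\<close>
        have "(r, u) \<in> (del A y)\<^sup>* \<and> u \<noteq> y"
          using ru
        proof (induction rule: rtrancl_induct)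
          case base
          then show ?case using rC y by auto
        next
          case (step u u')
          have "u' \<noteq> y"
          proof
            assume "u' = y"
            with step have "(r, y) \<in> (del A a)\<^sup>*" by (meson rtrancl_into_rtrancl)
            from sym_del[OF this] y rC show False
              using rtrancl_trans[of z y "del A a" r] by (auto simp: C_def)
          qed
          with step have "(u, u') \<in> del A y" by (auto simp: del_def)
          with step \<open>u' \<noteq> y\<close> show ?case by (meson rtrancl_into_rtrancl)
        qed
        with u show False by (simp add: desc_def)
      qed
    qed
    \<comment> \<open>Invariant along a walk from \<open>r\<close>: either \<open>a\<close> has been
      shown reachable without \<open>y\<close>, or the walk is still outside \<open>C\<close> and
      thus has not met \<open>y\<close>.\<close>
    have "(r, a) \<in> (del A y)\<^sup>* \<or> (u \<notin> C \<and> (r, u) \<in> (del A y)\<^sup>*)" if "(r, u) \<in> A\<^sup>*" for u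
      using that
    proof (induction rule: rtrancl_induct)
      case base
      then show ?case using rC by simp
    next
      case (step u u')
      show ?case
      proof (cases "(r, a) \<in> (del A y)\<^sup>*")
        case False
        with step have u: "u \<notin> C" "(r, u) \<in> (del A y)\<^sup>*" by auto
        with False have "u \<noteq> a" by auto
        then have "u' \<notin> C" using C_enter u step by blast
        then have "(u, u') \<in> del A y" using u y step by (auto simp: del_def)
        with u \<open>u' \<notin> C\<close> show ?thesis by (meson rtrancl_into_rtrancl)
      qed simp
    qed
    from this[of a] have "(r, a) \<in> (del A y)\<^sup>*"
      using assms connected_nodes by blast
    then have "a \<notin> desc r y" using aC y by (auto simp: desc_def)
    then show "desc r y \<noteq> desc r a" using \<open>a \<in> N\<close> by (auto simp: desc_def)
  qed
  moreover have "y \<in> N" using y(1) CN by blast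
  ultimately show ?thesis
    unfolding C_def[symmetric] by blast
qed

text \<open>
  \<open>X\<close> is the bag of a lowest node whose subtree contains more than \<open>c\<close> elements of \<open>M\<close>,
  \<open>L\<close> is the rest of that subtree, and \<open>g\<close> tells the subtrees of the children apart.
\<close>

lemma split_step:
  assumes "M \<subseteq> V" "finite M"
  obtains X L and g :: "'a \<Rightarrow> 't set" where
    "finite X" "card X \<le> K" "X \<subseteq> V" "X \<inter> L = {}"
    "\<And>v w. (v, w) \<in> E \<Longrightarrow> v \<notin> X \<Longrightarrow> w \<notin> X \<Longrightarrow> (v \<in> L \<longleftrightarrow> w \<in> L) \<and> g v = g w"
    "\<And>l. card {v \<in> M \<inter> L. g v = l} \<le> c"
    "card (M - X - L) \<le> max c (card M - c)"
proof (cases "card M \<le> c")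
  case True
  \<comment> \<open>An empty separator suffices; the \<open>max\<close> in the last conclusion
    accommodates this case.\<close>
  then show ?thesis
    by (intro that[of "{}" "{}" "\<lambda>_. {}"]) auto
next
  case False
  obtain r where r: "r \<in> N" using nodes_nonempty by blast
  define M_in where "M_in D = {v \<in> M. \<exists>z\<in>D. v \<in> B z}" for D
  have fin_in: "finite (M_in D)" for D using assms by (simp add: M_in_def)
  \<comment> \<open>The subtree of the root is the whole tree, so \<open>r\<close> is a candidate
    and a smallest candidate exists.\<close>
  have "M_in (desc r r) = M"
  proof -
    have "u = r" if "(r, u) \<in> (del A r)\<^sup>*" for u
      using that by (rule converse_rtranclE) (auto simp: del_def)
    then have "desc r r = N" by (auto simp: desc_def)
    then show ?thesis using assms bag_exists by (auto simp: M_in_def)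
  qed
  with r False have "r \<in> N \<and> card (M_in (desc r r)) > c" by simp
  from exE[OF ex_has_least_nat[of "\<lambda>a. a \<in> N \<and> card (M_in (desc r a)) > c", OF this,
        of "\<lambda>a. card (desc r a)"]]
  obtain a where a: "a \<in> N" "card (M_in (desc r a)) > c"
    and least: "\<And>y. y \<in> N \<Longrightarrow> card (M_in (desc r y)) > c \<Longrightarrow> card (desc r a) \<le> card (desc r y)"
    by metis
  \<comment> \<open>\<open>g v\<close> is the union of the components, in the tree without
    \<open>a\<close>, of the nodes whose bags contain \<open>v\<close>. For \<open>v\<close> outside
    \<open>B a\<close> these nodes share one component, which then serves as a label.\<close>
  define g where "g v = {z'. \<exists>z\<in>N. v \<in> B z \<and> (z, z') \<in> (del A a)\<^sup>*}" for v
  define L where "L = {v \<in> V - B a. r \<notin> g v}"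
  have one_comp: "(z, z') \<in> (del A a)\<^sup>*"
    if "z \<in> N" "z' \<in> N" "v \<in> B z" "v \<in> B z'" "v \<notin> B a" for v z z'
  proof -
    have "Restr A {x \<in> N. v \<in> B x} \<subseteq> del A a" using that by (auto simp: del_def)
    from rtrancl_mono[OF this] bags_connected that show ?thesis by blast
  qed
  have g_eq: "g v = (del A a)\<^sup>* `` {z}" if "z \<in> N" "v \<in> B z" "v \<notin> B a" for v z
  proof
    show "g v \<subseteq> (del A a)\<^sup>* `` {z}"
      using one_comp[OF that(1) _ that(2) _ that(3)] rtrancl_trans[of z _ "del A a"]
      by (auto simp: g_def)
    show "(del A a)\<^sup>* `` {z} \<subseteq> g v"
      using that by (auto simp: g_def)
  qed
  show ?thesis
  proof (rule that[of "B a" L g])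
    show "finite (B a)" "card (B a) \<le> K" "B a \<subseteq> V" "B a \<inter> L = {}"
      using a finite_bag card_bag bag_subset by (auto simp: L_def)
    show "(v \<in> L \<longleftrightarrow> w \<in> L) \<and> g v = g w" if vw: "(v, w) \<in> E" "v \<notin> B a" "w \<notin> B a" for v w
    proof -
      obtain z where z: "z \<in> N" "v \<in> B z" "w \<in> B z" using edge_in_bag vw by blast
      then have "v \<in> V" "w \<in> V" using bag_subset by auto
      moreover have "g v = g w" using g_eq z vw by simp
      ultimately show ?thesis using vw by (simp add: L_def)
    qed
    show "card {v \<in> M \<inter> L. g v = l} \<le> c" for l
    proof (cases "{v \<in> M \<inter> L. g v = l} = {}")
      case False
      then obtain v where v: "v \<in> M" "v \<in> L" "g v = l" by blast
      then have "v \<in> V" "v \<notin> B a" "r \<notin> g v" by (auto simp: L_def)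
      then obtain z where z: "z \<in> N" "v \<in> B z" using bag_exists by blast
      have l: "l = (del A a)\<^sup>* `` {z}" using g_eq z v \<open>v \<notin> B a\<close> by simp
      have "z \<noteq> a" using z \<open>v \<notin> B a\<close> by blast
      moreover have "(z, r) \<notin> (del A a)\<^sup>*" using l v \<open>r \<notin> g v\<close> by simp
      \<comment> \<open>The component labelling the class lies in a strictly smaller subtree, so
        minimality of \<open>a\<close> bounds the class by \<open>c\<close>.\<close>
      ultimately obtain y where y: "y \<in> N" "l \<subseteq> desc r y" "desc r y \<subset> desc r a"
        using comp_subset_desc[OF r a(1) z(1)] l by blast
      have "finite (desc r a)" using finite_nodes by (simp add: desc_def)
      then have "card (desc r y) < card (desc r a)" using y by (simp add: psubset_card_mono)
      with least[OF y(1)] have "card (M_in (desc r y)) \<le> c" by force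
      moreover have "{v \<in> M \<inter> L. g v = l} \<subseteq> M_in (desc r y)"
      proof
        fix w assume w: "w \<in> {v \<in> M \<inter> L. g v = l}"
        then have "w \<in> V" by (auto simp: L_def)
        then obtain z' where z': "z' \<in> N" "w \<in> B z'" using bag_exists by blast
        then have "z' \<in> g w" by (auto simp: g_def)
        with w y z' show "w \<in> M_in (desc r y)" by (auto simp: M_in_def)
      qed
      then have "card {v \<in> M \<inter> L. g v = l} \<le> card (M_in (desc r y))"
        by (rule card_mono[OF fin_in])
      ultimately show ?thesis by simp
    next
      case True
      then show ?thesis by (simp only: card.empty zero_le)
    qed
    \<comment> \<open>Hence \<open>B a\<close> and \<open>L\<close> together absorb more than
      \<open>c\<close> elements of \<open>M\<close>.\<close>
    have "M_in (desc r a) \<subseteq> B a \<union> L"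
    proof
      fix v assume "v \<in> M_in (desc r a)"
      then obtain z where v: "v \<in> M" and z: "z \<in> desc r a" "v \<in> B z" by (auto simp: M_in_def)
      show "v \<in> B a \<union> L"
      proof (cases "v \<in> B a")
        case False
        with z have "z \<in> N" "(r, z) \<notin> (del A a)\<^sup>*" by (auto simp: desc_def)
        with False z g_eq[of z v] sym_del[of z r] have "r \<notin> g v" by auto
        with False v assms show ?thesis by (auto simp: L_def)
      qed simp
    qed
    then have "M - B a - L \<subseteq> M - M_in (desc r a)" by blast
    then have "card (M - B a - L) \<le> card (M - M_in (desc r a))"
      using assms by (intro card_mono) auto
    also have "\<dots> = card M - card (M_in (desc r a))"
      using fin_in by (intro card_Diff_subset) (auto simp: M_in_def)
    also have "\<dots> \<le> max c (card M - c)" using a by simp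
    finally show "card (M - B a - L) \<le> max c (card M - c)" .
  qed
qed

text \<open>Induction on the number \<open>n\<close> of labels. With at least six labels, two
  classes of joint size at most \<open>c\<close> exist, since otherwise three disjoint pairs would
  exceed \<open>3 * c\<close>; merging them saves one label.\<close>

lemma merge_classes:
  fixes h :: "'b \<Rightarrow> nat"
  assumes "finite M" "card M \<le> 3 * c"
    and "\<And>i. card {v \<in> M. h v = i} \<le> c" and "\<And>v. v \<in> W \<Longrightarrow> h v < n"
  shows "\<exists>f. (\<forall>v\<in>W. f (h v) < (5::nat)) \<and> (\<forall>i. card {v \<in> M. f (h v) = i} \<le> c)"
  using assms(3,4)
proof (induction n arbitrary: h)
  case 0
  then show ?case by (intro exI[of _ id]) auto
next
  case (Suc m)
  show ?case
  proof (cases "Suc m \<le> 5")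
    case True
    with Suc.prems show ?thesis by (intro exI[of _ id]) force
  next
    case False
    define wt where "wt i = card {v \<in> M. h v = i}" for i
    have "\<exists>i j. i < j \<and> j \<le> m \<and> wt i + wt j \<le> c"
    proof (rule ccontr)
      assume "\<not> ?thesis"
      then have big: "wt i + wt j > c" if "i < j" "j \<le> m" for i j
        using that by (meson not_le)
      have "(\<Sum>i<6. wt i) = card (\<Union>i<6. {v \<in> M. h v = i})"
        unfolding wt_def using assms(1) by (subst card_UN_disjoint) auto
      also have "\<dots> \<le> card M" using assms(1) by (intro card_mono) auto
      finally have "(\<Sum>i<6. wt i) \<le> 3 * c" using assms(2) by simp
      moreover have "(\<Sum>i<6. wt i) = wt 0 + wt 1 + wt 2 + wt 3 + wt 4 + wt 5"
        by (simp add: eval_nat_numeral)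
      ultimately show False
        using big[of 0 1] big[of 2 3] big[of 4 5] False by simp
    qed
    then obtain i j where ij: "i < j" "j \<le> m" "wt i + wt j \<le> c" by blast
    \<comment> \<open>Label \<open>j\<close> is merged into \<open>i\<close>, and the last label
      \<open>m\<close> moves to the freed \<open>j\<close>, so labels stay below \<open>m\<close>.
      Every new class other than \<open>i\<close> lies in one old class.\<close>
    define p where "p l = (if l = j then i else if l = m then j else l)" for l
    have "card {v \<in> M. p (h v) = l} \<le> c" for l
    proof (cases "l = i")
      case True
      have "{v \<in> M. p (h v) = l} \<subseteq> {v \<in> M. h v = i} \<union> {v \<in> M. h v = j}"
        using True ij by (auto simp: p_def split: if_splits)
      then have "card {v \<in> M. p (h v) = l} \<le> card ({v \<in> M. h v = i} \<union> {v \<in> M. h v = j})"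
        using assms(1) by (intro card_mono) auto
      also have "\<dots> \<le> wt i + wt j" unfolding wt_def by (rule card_Un_le)
      finally show ?thesis using ij by simp
    next
      case False
      have "{v \<in> M. p (h v) = l} \<subseteq> {v \<in> M. h v = (if l = j then m else l)}"
        using False by (auto simp: p_def split: if_splits)
      then have "card {v \<in> M. p (h v) = l} \<le> card {v \<in> M. h v = (if l = j then m else l)}"
        using assms(1) by (intro card_mono) auto
      also have "\<dots> \<le> c" by (rule Suc.prems)
      finally show ?thesis .
    qed
    moreover have "p (h v) < m" if "v \<in> W" for v
      using Suc.prems(2)[OF that] ij by (auto simp: p_def)
    ultimately obtain f where "\<forall>v\<in>W. f (p (h v)) < (5::nat)" "\<forall>l. card {v \<in> M. f (p (h v)) = l} \<le> c"
      using Suc.IH[of "\<lambda>v. p (h v)"] by blast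
    then show ?thesis by (intro exI[of _ "f \<circ> p"]) simp
  qed
qed

text \<open>Two cuts suffice for \<open>3 * c\<close>: the first leaves at most \<open>2 * c\<close>
  elements of \<open>M\<close> unclassified, the second at most \<open>c\<close>, and these form one
  further class.\<close>

lemma separation:
  assumes "finite V" "M \<subseteq> V" "card M \<le> 3 * c"
  obtains X and h :: "'a \<Rightarrow> nat" where
    "X \<subseteq> V" "card X \<le> 2 * K"
    "\<And>v. v \<in> V \<Longrightarrow> h v < 5"
    "\<And>v w. (v, w) \<in> E \<Longrightarrow> v \<notin> X \<Longrightarrow> w \<notin> X \<Longrightarrow> h v = h w"
    "\<And>i. card {v \<in> M - X. h v = i} \<le> c"
proof -
  have fin: "finite M" using assms finite_subset by blast
  obtain X1 L1 and g1 :: "'a \<Rightarrow> 't set" where 1: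
    "finite X1" "card X1 \<le> K" "X1 \<subseteq> V" "X1 \<inter> L1 = {}"
    "\<And>v w. (v, w) \<in> E \<Longrightarrow> v \<notin> X1 \<Longrightarrow> w \<notin> X1 \<Longrightarrow> (v \<in> L1 \<longleftrightarrow> w \<in> L1) \<and> g1 v = g1 w"
    "\<And>l. card {v \<in> M \<inter> L1. g1 v = l} \<le> c"
    "card (M - X1 - L1) \<le> max c (card M - c)"
    by (rule split_step[OF assms(2) fin, of c]) (rule that)
  have "M - X1 - L1 \<subseteq> V" "finite (M - X1 - L1)" using assms fin by auto
  then obtain X2 L2 and g2 :: "'a \<Rightarrow> 't set" where 2:
    "finite X2" "card X2 \<le> K" "X2 \<subseteq> V" "X2 \<inter> L2 = {}"
    "\<And>v w. (v, w) \<in> E \<Longrightarrow> v \<notin> X2 \<Longrightarrow> w \<notin> X2 \<Longrightarrow> (v \<in> L2 \<longleftrightarrow> w \<in> L2) \<and> g2 v = g2 w"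
    "\<And>l. card {v \<in> (M - X1 - L1) \<inter> L2. g2 v = l} \<le> c"
    "card (M - X1 - L1 - X2 - L2) \<le> max c (card (M - X1 - L1) - c)"
    by (rule split_step[of _ c]) (rule that)
  \<comment> \<open>The first component records which cut classified \<open>v\<close>; 2 marks the
    common remainder. Labels agree along edges outside both separators.\<close>
  define lab where "lab v = (if v \<in> L1 then (0::nat, g1 v) else if v \<in> L2 then (1, g2 v) else (2, {}))" for v
  have lab_adj: "lab v = lab w" if "(v, w) \<in> E" "v \<notin> X1 \<union> X2" "w \<notin> X1 \<union> X2" for v w
    using 1(5)[of v w] 2(5)[of v w] that by (auto simp: lab_def)
  have lab_card: "card {v \<in> M - (X1 \<union> X2). lab v = l} \<le> c" for l
  proof -
    obtain i s where l: "l = (i, s)" by fastforce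
    have "card (M - X1 - L1 - X2 - L2) \<le> c" using 1(7) 2(7) assms(3) by simp
    moreover have "{v \<in> M - (X1 \<union> X2). lab v = l} \<subseteq>
        (if i = 0 then {v \<in> M \<inter> L1. g1 v = s}
         else if i = 1 then {v \<in> (M - X1 - L1) \<inter> L2. g2 v = s}
         else M - X1 - L1 - X2 - L2)" (is "?A \<subseteq> ?B")
      by (auto simp: lab_def l split: if_splits)
    moreover have "finite ?B" using fin by auto
    ultimately have "card ?A \<le> card ?B" by (intro card_mono)
    also have "\<dots> \<le> c" using 1(6)[of s] 2(6)[of s] \<open>card (M - X1 - L1 - X2 - L2) \<le> c\<close> by simp
    finally show ?thesis .
  qed
  \<comment> \<open>Merging expects an initial segment of the naturals as labels, so the finitely
    many labels on \<open>V\<close> are numbered.\<close>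
  have "finite (lab ` V)" using assms by simp
  from finite_imp_inj_to_nat_seg[OF this] obtain n and e :: "_ \<Rightarrow> nat"
    where e: "e ` (lab ` V) = {i. i < n}" "inj_on e (lab ` V)"
    by (elim exE conjE) (rule that)
  have "card {v \<in> M - (X1 \<union> X2). e (lab v) = i} \<le> c" for i
  proof (cases "{v \<in> M - (X1 \<union> X2). e (lab v) = i} = {}")
    case False
    then obtain u where u: "u \<in> M" "e (lab u) = i" by blast
    have "{v \<in> M - (X1 \<union> X2). e (lab v) = i} \<subseteq> {v \<in> M - (X1 \<union> X2). lab v = lab u}"
    proof
      fix v assume v: "v \<in> {v \<in> M - (X1 \<union> X2). e (lab v) = i}"
      then have "e (lab v) = e (lab u)" "lab v \<in> lab ` V" "lab u \<in> lab ` V"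
        using u assms(2) by auto
      then have "lab v = lab u" by (rule inj_onD[OF e(2)])
      with v show "v \<in> {v \<in> M - (X1 \<union> X2). lab v = lab u}" by simp
    qed
    then have "card {v \<in> M - (X1 \<union> X2). e (lab v) = i} \<le> card {v \<in> M - (X1 \<union> X2). lab v = lab u}"
      using fin by (intro card_mono) auto
    then show ?thesis using lab_card[of "lab u"] by simp
  next
    case True
    then show ?thesis by (simp only: card.empty zero_le)
  qed
  moreover have "card (M - (X1 \<union> X2)) \<le> 3 * c"
    using card_mono[OF fin, of "M - (X1 \<union> X2)"] assms by auto
  moreover have "e (lab v) < n" if "v \<in> V" for v
    using imageI[OF imageI[OF that, of lab], of e] by (simp add: e(1))
  ultimately obtain f where f: "\<forall>v\<in>V. f (e (lab v)) < (5::nat)"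
      "\<forall>i. card {v \<in> M - (X1 \<union> X2). f (e (lab v)) = i} \<le> c"
    using merge_classes[of "M - (X1 \<union> X2)" c "\<lambda>v. e (lab v)" V n] fin by auto
  show ?thesis
  proof (rule that[of "X1 \<union> X2" "\<lambda>v. f (e (lab v))"])
    show "X1 \<union> X2 \<subseteq> V" using 1 2 by simp
    show "card (X1 \<union> X2) \<le> 2 * K" using 1(2) 2(2) card_Un_le[of X1 X2] by linarith
  qed (use f lab_adj in auto)
qed

end

section \<open>Recursive construction\<close>

text \<open>
  Nodes are the paths from the root, so the parent of \<open>p @ [i]\<close> is \<open>p\<close>; entries below 5
  keep the degree at most 6. Only the pairs of \<open>E\<close> inside \<open>V\<close> have to be covered by a bag.
\<close>

locale slick_list_dec =
  fixes E :: "'a rel" and b :: nat and V S :: "'a set"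
    and N :: "nat list set" and B :: "nat list \<Rightarrow> 'a set"
  assumes finite_nodes: "finite N" and root_in: "[] \<in> N" and root_bag: "S \<subseteq> B []"
    and parent_in: "p @ [i] \<in> N \<Longrightarrow> p \<in> N" and child_less: "p @ [i] \<in> N \<Longrightarrow> i < 5"
    and bag_subset: "p \<in> N \<Longrightarrow> B p \<subseteq> V" and card_bag: "p \<in> N \<Longrightarrow> card (B p) \<le> b"
    and edge_in_bag: "v \<in> V \<Longrightarrow> w \<in> V \<Longrightarrow> (v, w) \<in> E \<Longrightarrow> \<exists>p\<in>N. v \<in> B p \<and> w \<in> B p"
    and top_node: "v \<in> V \<Longrightarrow> \<exists>t\<in>N. v \<in> B t \<and> (v \<in> B [] \<longrightarrow> t = []) \<and>
        (\<forall>p i. p @ [i] \<in> N \<longrightarrow> v \<in> B (p @ [i]) \<longrightarrow> p @ [i] = t \<or> v \<in> B p)"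
    and slick_arc: "p @ [i] \<in> N \<Longrightarrow> v \<in> B p \<Longrightarrow> v \<in> B (p @ [i]) \<Longrightarrow>
        \<exists>w. (v, w) \<in> E \<and> w \<in> B (p @ [i]) - B p"

text \<open>Hangs the decompositions of the groups \<open>U i\<close>, each with its attachment
  \<open>R i Q\<close>, below a new root bag \<open>Q\<close>. \<open>RS\<close> keeps the nodes of
  an attached vertex connected through the root; \<open>nb\<close> supplies the new neighbours that
  make the arcs at the root slick.\<close>

lemma slick_list_dec_graft:
  fixes U :: "nat \<Rightarrow> 'a set" and E :: "'a rel"
  defines "R \<equiv> \<lambda>i Q. {v \<in> Q. \<exists>w\<in>U i. (v, w) \<in> E}"
  assumes I: "I \<subseteq> {..<5}" and "sym E"
    and dec: "\<And>i. i \<in> I \<Longrightarrow> slick_list_dec E b (U i \<union> R i Q) (S i) (N i) (B i)"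
    and Q: "S\<^sub>0 \<subseteq> Q" "Q \<subseteq> V" "card Q \<le> b"
    and cover: "V - Q = (\<Union>i\<in>I. U i)"
    and disj: "\<And>i j v. i \<in> I \<Longrightarrow> j \<in> I \<Longrightarrow> v \<in> U i \<Longrightarrow> v \<in> U j \<Longrightarrow> i = j"
    and anti: "\<And>i j v w. i \<in> I \<Longrightarrow> j \<in> I \<Longrightarrow> v \<in> U i \<Longrightarrow> w \<in> U j \<Longrightarrow> (v, w) \<in> E \<Longrightarrow> i = j"
    and RS: "\<And>i. i \<in> I \<Longrightarrow> R i Q \<subseteq> S i"
    and nb: "\<And>i v. i \<in> I \<Longrightarrow> v \<in> R i Q \<Longrightarrow> \<exists>w \<in> S i \<inter> U i. (v, w) \<in> E"
  shows "slick_list_dec E b V S\<^sub>0 (insert [] (\<Union>i\<in>I. (#) i ` N i))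
    (\<lambda>p. case p of [] \<Rightarrow> Q | i # q \<Rightarrow> B i q)" (is "slick_list_dec E b V S\<^sub>0 ?N ?B")
proof -
  have snoc: "(\<exists>i q'. p = i # q' \<and> i \<in> I \<and> q' @ [j] \<in> N i) \<or> (p = [] \<and> j \<in> I)"
    if "p @ [j] \<in> ?N" for p j
    using that by (cases p) auto
  have UV: "U i \<subseteq> V - Q" if "i \<in> I" for i using cover that by blast
  have RQ: "R i Q \<subseteq> Q" for i by (auto simp: R_def)
  \<comment> \<open>A vertex of \<open>Q\<close> used anywhere in a branch is attached to it and so
    appears already in the root bag of the branch.\<close>
  have inQ: "v \<in> B i []" if "i \<in> I" "q \<in> N i" "v \<in> B i q" "v \<in> Q" for i q v
  proof -
    have "v \<in> U i \<union> R i Q" using slick_list_dec.bag_subset[OF dec, OF that(1,2)] that by blast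
    then show ?thesis using UV[OF that(1)] that RS slick_list_dec.root_bag[OF dec] by blast
  qed
  show ?thesis
  proof
    have "finite I" using finite_subset[OF I] by simp
    then show "finite ?N" using slick_list_dec.finite_nodes[OF dec] by simp
    show "[] \<in> ?N" "S\<^sub>0 \<subseteq> ?B []" using Q by simp_all
  next
    fix p j assume "p @ [j] \<in> ?N"
    from snoc[OF this] have "p \<in> ?N \<and> j < 5"
    proof (elim disjE exE conjE)
      fix i q assume p: "p = i # q" "i \<in> I" "q @ [j] \<in> N i"
      show ?thesis
        using p slick_list_dec.parent_in[OF dec, OF p(2,3)] slick_list_dec.child_less[OF dec, OF p(2,3)]
        by auto
    qed (use I in auto)
    then show "p \<in> ?N" "j < 5" by simp_all
  next
    fix p assume p: "p \<in> ?N"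
    have "?B p \<subseteq> V \<and> card (?B p) \<le> b"
    proof (cases p)
      case (Cons i q)
      with p have iq: "i \<in> I" "q \<in> N i" by auto
      have "B i q \<subseteq> V"
        using slick_list_dec.bag_subset[OF dec, OF iq] UV[OF iq(1)] RQ[of i] Q(2) by blast
      with slick_list_dec.card_bag[OF dec, OF iq] Cons show ?thesis by simp
    qed (use Q in simp)
    then show "?B p \<subseteq> V" "card (?B p) \<le> b" by simp_all
  next
    fix v w assume vw: "v \<in> V" "w \<in> V" "(v, w) \<in> E"
    show "\<exists>p\<in>?N. v \<in> ?B p \<and> w \<in> ?B p"
    proof (cases "v \<in> Q \<and> w \<in> Q")
      case True
      then show ?thesis by (intro bexI[of _ "[]"]) auto
    next
      case False
      \<comment> \<open>An edge not inside \<open>Q\<close> lies in a single group together with its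
        attachment.\<close>
      have "\<exists>i\<in>I. v \<in> U i \<union> R i Q \<and> w \<in> U i \<union> R i Q"
      proof (cases "v \<in> Q")
        case True
        with False vw have "w \<in> (\<Union>i\<in>I. U i)" using cover by blast
        then obtain i where "i \<in> I" "w \<in> U i" by blast
        with True vw show ?thesis by (auto simp: R_def)
      next
        case vQ: False
        with vw have "v \<in> (\<Union>i\<in>I. U i)" using cover by blast
        then obtain i where i: "i \<in> I" "v \<in> U i" by blast
        show ?thesis
        proof (cases "w \<in> Q")
          case True
          with i symD[OF \<open>sym E\<close> vw(3)] show ?thesis by (auto simp: R_def)
        next
          case False
          with vw have "w \<in> (\<Union>i\<in>I. U i)" using cover by blast
          then obtain j where j: "j \<in> I" "w \<in> U j" by blast
          from anti[OF i(1) j(1) i(2) j(2) vw(3)] i j show ?thesis by blast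
        qed
      qed
      then obtain i where i: "i \<in> I" "v \<in> U i \<union> R i Q" "w \<in> U i \<union> R i Q" by blast
      from slick_list_dec.edge_in_bag[OF dec, OF i vw(3)]
      obtain p where "p \<in> N i" "v \<in> B i p" "w \<in> B i p" by blast
      with i(1) show ?thesis by (intro bexI[of _ "i # p"]) auto
    qed
  next
    fix v assume v: "v \<in> V"
    show "\<exists>t\<in>?N. v \<in> ?B t \<and> (v \<in> ?B [] \<longrightarrow> t = []) \<and>
        (\<forall>p i. p @ [i] \<in> ?N \<longrightarrow> v \<in> ?B (p @ [i]) \<longrightarrow> p @ [i] = t \<or> v \<in> ?B p)"
    proof (cases "v \<in> Q")
      case True
      have "v \<in> ?B p" if pj: "p @ [j] \<in> ?N" "v \<in> ?B (p @ [j])" for p j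
        using snoc[OF pj(1)]
      proof (elim disjE exE conjE)
        fix i q assume p: "p = i # q" "i \<in> I" "q @ [j] \<in> N i"
        with pj have vq: "v \<in> B i (q @ [j])" by simp
        have vi: "v \<in> B i []" using inQ[OF p(2,3) vq True] .
        have "v \<in> U i \<union> R i Q" using slick_list_dec.bag_subset[OF dec, OF p(2,3)] vq by blast
        \<comment> \<open>Within the branch the top node of \<open>v\<close> is \<open>[]\<close>,
          so no proper descendant can be it and the parent bag contains \<open>v\<close>.\<close>
        from slick_list_dec.top_node[OF dec, OF p(2) this]
        have "v \<in> B i q" using p(3) vi vq by auto
        then show ?thesis using p by simp
      qed (use True in simp)
      with True show ?thesis by (intro bexI[of _ "[]"]) auto
    next
      case False
      with v have "v \<in> (\<Union>i\<in>I. U i)" using cover by blast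
      then obtain i where i: "i \<in> I" "v \<in> U i" by blast
      then have "v \<in> U i \<union> R i Q" by simp
      from slick_list_dec.top_node[OF dec, OF i(1) this]
      obtain t where t: "t \<in> N i" "v \<in> B i t" "v \<in> B i [] \<longrightarrow> t = []"
        "\<forall>p j. p @ [j] \<in> N i \<longrightarrow> v \<in> B i (p @ [j]) \<longrightarrow> p @ [j] = t \<or> v \<in> B i p"
        by (elim bexE conjE) (rule that)
      have same: "j = i" if j: "j \<in> I" "q \<in> N j" "v \<in> B j q" for j q
      proof -
        have "v \<in> U j" using slick_list_dec.bag_subset[OF dec, OF j(1,2)] j(3) False RQ by blast
        from disj[OF j(1) i(1) this i(2)] show ?thesis .
      qed
      have "p @ [j] = i # t \<or> v \<in> ?B p" if pj: "p @ [j] \<in> ?N" "v \<in> ?B (p @ [j])" for p j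
        using snoc[OF pj(1)]
      proof (elim disjE exE conjE)
        fix l q assume p: "p = l # q" "l \<in> I" "q @ [j] \<in> N l"
        with pj have vq: "v \<in> B l (q @ [j])" by simp
        have "l = i" by (rule same[OF p(2,3) vq])
        with t(4) p vq show ?thesis by simp
      next
        assume p: "p = []" "j \<in> I"
        with pj have vj: "v \<in> B j []" by simp
        have "j = i" by (rule same[OF p(2) slick_list_dec.root_in[OF dec, OF p(2)] vj])
        with t(3) vj p show ?thesis by simp
      qed
      with i t False show ?thesis by (intro bexI[of _ "i # t"]) auto
    qed
  next
    fix p j v assume pj: "p @ [j] \<in> ?N" "v \<in> ?B p" "v \<in> ?B (p @ [j])"
    from snoc[OF pj(1)] show "\<exists>w. (v, w) \<in> E \<and> w \<in> ?B (p @ [j]) - ?B p"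
    proof (elim disjE exE conjE)
      fix i q assume p: "p = i # q" "i \<in> I" "q @ [j] \<in> N i"
      with pj slick_list_dec.slick_arc[OF dec, OF p(2,3), of v] show ?thesis by simp
    next
      assume p: "p = []" "j \<in> I"
      with pj have v: "v \<in> B j []" "v \<in> Q" by auto
      \<comment> \<open>\<open>U j\<close> is disjoint from \<open>Q\<close>, so the shared vertex
        is an attached one.\<close>
      have "v \<in> R j Q"
        using slick_list_dec.bag_subset[OF dec, OF p(2) slick_list_dec.root_in[OF dec, OF p(2)]]
          v UV[OF p(2)] by blast
      from nb[OF p(2) this] obtain w where "w \<in> S j" "w \<in> U j" "(v, w) \<in> E" by blast
      then show ?thesis using slick_list_dec.root_bag[OF dec, OF p(2)] UV[OF p(2)] p by auto
    qed
  qed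
qed

text \<open>One chosen neighbour per vertex of \<open>R\<close> at most doubles the size. That
  \<open>S\<close> meets \<open>U\<close> will make the recursion terminate.\<close>

lemma small_attachment:
  assumes "finite R" "card R \<le> m" "1 \<le> m" "U \<noteq> {}" and nb: "\<And>v. v \<in> R \<Longrightarrow> \<exists>w\<in>U. (v, w) \<in> E"
  obtains S where "R \<subseteq> S" "S \<subseteq> R \<union> U" "S \<inter> U \<noteq> {}" "card S \<le> 2 * m"
    "\<And>v. v \<in> R \<Longrightarrow> \<exists>w\<in>S \<inter> U. (v, w) \<in> E"
proof -
  obtain f where f: "\<And>v. v \<in> R \<Longrightarrow> f v \<in> U \<and> (v, f v) \<in> E" using nb by metis
  obtain u where "u \<in> U" using assms by blast
  \<comment> \<open>If \<open>R\<close> is empty no neighbour gets chosen, so an arbitrary vertex of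
    \<open>U\<close> is taken; \<open>1 \<le> m\<close> pays for it.\<close>
  define W where "W = (if R = {} then {u} else f ` R)"
  have "card W \<le> m"
    using assms card_image_le[of R f] by (auto simp: W_def)
  then have "card (R \<union> W) \<le> 2 * m"
    using assms(2) card_Un_le[of R W] by simp
  then show ?thesis
    using f \<open>u \<in> U\<close> by (intro that[of "R \<union> W"]) (auto simp: W_def split: if_splits)
qed

text \<open>The separators always come from the fixed decomposition of all of \<open>V\<close>; only
  \<open>V'\<close> and \<open>S\<close> shrink or change, so the given tree never has to be
  restricted.\<close>

lemma (in abstract_tree_decomposition) slick_list_dec_exists:
  assumes "finite V" "sym E" "1 \<le> K"
  assumes "V' \<subseteq> V" "S \<subseteq> V'" "card S \<le> 12 * K"
  shows "\<exists>N B. slick_list_dec E (14 * K) V' S N B"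
  using assms(4-6)
proof (induction "card (V' - S)" arbitrary: V' S rule: less_induct)
  case less
  have finV: "finite V'" by (rule finite_subset[OF less.prems(1) assms(1)])
  have finS: "finite S" by (rule finite_subset[OF less.prems(2) finV])
  have "S \<subseteq> V" "card S \<le> 3 * (4 * K)" using less.prems by auto
  then obtain X and h :: "'a \<Rightarrow> nat" where X: "X \<subseteq> V" "card X \<le> 2 * K"
    and h: "\<And>v. v \<in> V \<Longrightarrow> h v < 5"
      "\<And>v w. (v, w) \<in> E \<Longrightarrow> v \<notin> X \<Longrightarrow> w \<notin> X \<Longrightarrow> h v = h w"
      "\<And>i. card {v \<in> S - X. h v = i} \<le> 4 * K"
    by (rule separation[OF assms(1)]) (rule that)
  have finX: "finite X" by (rule finite_subset[OF X(1) assms(1)])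
  define Q where "Q = S \<union> X \<inter> V'"
  define U where "U i = {v \<in> V' - Q. h v = i}" for i
  define R where "R i = {v \<in> Q. \<exists>w\<in>U i. (v, w) \<in> E}" for i
  define I where "I = {i. i < 5 \<and> U i \<noteq> {}}"
  have U: "w \<in> V'" "w \<notin> S" "w \<notin> X" "h w = i" if "w \<in> U i" for w i
    using that by (auto simp: U_def Q_def)
  have "\<exists>S' N B. slick_list_dec E (14 * K) (U i \<union> R i) S' N B \<and> R i \<subseteq> S' \<and>
      (\<forall>v\<in>R i. \<exists>w\<in>S' \<inter> U i. (v, w) \<in> E)" if "i \<in> I" for i
  proof -
    \<comment> \<open>An attached vertex outside \<open>X\<close> lies in \<open>S\<close> and
      carries the label of its neighbour in \<open>U i\<close>.\<close>
    have "R i \<subseteq> {v \<in> S - X. h v = i} \<union> X"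
      using h(2) U by (fastforce simp: R_def Q_def)
    then have "card (R i) \<le> card ({v \<in> S - X. h v = i} \<union> X)"
      using finS finX by (intro card_mono) auto
    also have "\<dots> \<le> 6 * K"
      using card_Un_le[of "{v \<in> S - X. h v = i}" X] h(3)[of i] X by simp
    finally have "card (R i) \<le> 6 * K" .
    moreover have "finite (R i)" using finS finX by (simp add: R_def Q_def)
    moreover have "U i \<noteq> {}" using that by (simp add: I_def)
    moreover have "\<exists>w\<in>U i. (v, w) \<in> E" if "v \<in> R i" for v using that by (simp add: R_def)
    ultimately obtain S' where S': "R i \<subseteq> S'" "S' \<subseteq> R i \<union> U i" "S' \<inter> U i \<noteq> {}"
      "card S' \<le> 2 * (6 * K)" "\<And>v. v \<in> R i \<Longrightarrow> \<exists>w\<in>S' \<inter> U i. (v, w) \<in> E"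
      using small_attachment[of "R i" "6 * K" "U i" E] assms(3) by auto
    have sub: "U i \<union> R i \<subseteq> V'" using less.prems by (auto simp: U_def R_def Q_def)
    \<comment> \<open>All of \<open>R i\<close> is in \<open>S'\<close>, and \<open>U i\<close>
      avoids \<open>S\<close>; strictness comes from a vertex in
      \<open>S' \<inter> U i\<close>.\<close>
    have "U i \<union> R i - S' \<subset> V' - S"
      using S' U by (auto simp: R_def)
    then have "card (U i \<union> R i - S') < card (V' - S)"
      using finV by (intro psubset_card_mono) auto
    moreover have "U i \<union> R i \<subseteq> V" "S' \<subseteq> U i \<union> R i" "card S' \<le> 12 * K"
      using sub less.prems S' by auto
    ultimately have "\<exists>N B. slick_list_dec E (14 * K) (U i \<union> R i) S' N B"
      by (rule less.hyps)
    then show ?thesis using S' by blast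
  qed
  then obtain S' N B where sub: "\<And>i. i \<in> I \<Longrightarrow> slick_list_dec E (14 * K) (U i \<union> R i) (S' i) (N i) (B i)"
    "\<And>i. i \<in> I \<Longrightarrow> R i \<subseteq> S' i"
    "\<And>i v. i \<in> I \<Longrightarrow> v \<in> R i \<Longrightarrow> \<exists>w\<in>S' i \<inter> U i. (v, w) \<in> E"
    by metis
  have "card Q \<le> card S + card (X \<inter> V')" unfolding Q_def by (rule card_Un_le)
  moreover have "card (X \<inter> V') \<le> card X" using finX by (intro card_mono) auto
  ultimately have "card Q \<le> 14 * K" using less.prems X by simp
  have "slick_list_dec E (14 * K) V' S (insert [] (\<Union>i\<in>I. (#) i ` N i))
      (\<lambda>p. case p of [] \<Rightarrow> Q | i # q \<Rightarrow> B i q)"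
  proof (rule slick_list_dec_graft[where U = U and S = S', OF _ assms(2)])
    show "I \<subseteq> {..<5}" by (auto simp: I_def)
    show "S \<subseteq> Q" by (simp add: Q_def)
    show "Q \<subseteq> V'" using less.prems by (auto simp: Q_def)
    show "V' - Q = (\<Union>i\<in>I. U i)"
      using h(1) less.prems by (auto simp: I_def U_def)
    show "i = j" if "v \<in> U i" "v \<in> U j" for i j v
      using U(4)[OF that(1)] U(4)[OF that(2)] by simp
    show "i = j" if "v \<in> U i" "w \<in> U j" "(v, w) \<in> E" for i j v w
      using h(2)[OF that(3) U(3)[OF that(1)] U(3)[OF that(2)]] U(4)[OF that(1)] U(4)[OF that(2)]
      by simp
  qed (use sub \<open>card Q \<le> 14 * K\<close> in \<open>auto simp: R_def\<close>)
  then show ?case by blast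
qed

section \<open>Trees given by a parent function\<close>

text \<open>The decreasing rank makes every climb end at the root and excludes cycles; path length
  will serve as rank.\<close>

locale parent_tree =
  fixes N :: "'t set" and r :: 't and par :: "'t \<Rightarrow> 't" and rk :: "'t \<Rightarrow> nat"
  assumes finite_N: "finite N" and root_in: "r \<in> N"
    and par_in: "y \<in> N \<Longrightarrow> y \<noteq> r \<Longrightarrow> par y \<in> N"
    and rk_par: "y \<in> N \<Longrightarrow> y \<noteq> r \<Longrightarrow> rk (par y) < rk y"
begin

definition up :: "'t rel" where
  "up = {(y, par y) |y. y \<in> N \<and> y \<noteq> r}"

definition ptree :: "'t pair_pre_digraph" where
  "ptree = \<lparr>pverts = N, parcs = up \<union> up\<inverse>\<rparr>"

lemma ptree_simps [simp]: "pverts ptree = N" "parcs ptree = up \<union> up\<inverse>"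
  by (simp_all add: ptree_def)

lemma up_iff: "(x, y) \<in> up \<longleftrightarrow> x \<in> N \<and> x \<noteq> r \<and> y = par x"
  by (auto simp: up_def)

lemma pair_graph_tree: "pair_graph ptree"
proof
  have "up \<subseteq> N \<times> N" using par_in by (auto simp: up_def)
  then show "finite (parcs ptree)"
    using finite_subset[of up "N \<times> N"] finite_N by simp
  show "fst e \<noteq> snd e" if "e \<in> parcs ptree" for e
    using that rk_par by (cases e) (force simp: up_iff)
  show "symmetric (with_proj ptree)"
    by (auto simp: symmetric_def sym_def)
qed (use par_in finite_N in \<open>auto simp: up_iff\<close>)

lemma up_rtrancl_rk: "(z, x) \<in> up\<^sup>* \<Longrightarrow> rk x \<le> rk z"
  by (induction rule: rtrancl_induct)
    (use rk_par in \<open>auto simp: up_iff dest: order.strict_implies_order order_trans\<close>)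

text \<open>The nodes below \<open>x\<close> can be left only by the arc from \<open>x\<close> to
  its parent. Both the bridge property and the identification of \<open>parent_of\<close> rest on
  this.\<close>

lemma subtree_step:
  assumes "(z, z') \<in> parcs ptree" "(z, x) \<in> up\<^sup>*" "(z, z') \<noteq> (x, par x)"
  shows "(z', x) \<in> up\<^sup>*"
  using assms(1)
proof (simp, elim disjE)
  assume "(z, z') \<in> up"
  then have z': "z' = par z" by (simp add: up_iff)
  with assms have "z \<noteq> x" by auto
  with assms(2) obtain u where "(z, u) \<in> up" "(u, x) \<in> up\<^sup>*"
    by (meson converse_rtranclE)
  with z' show ?thesis by (simp add: up_iff)
next
  assume "(z', z) \<in> up"
  then show ?thesis using assms(2) by (rule converse_rtrancl_into_rtrancl)
qed

text \<open>Ranks drop along parents, so each node of \<open>U\<close> climbs inside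
  \<open>U\<close> until it meets \<open>t\<close>.\<close>

lemma connected_subtree:
  assumes "U \<subseteq> N" "t \<in> U" "\<And>y. y \<in> U \<Longrightarrow> y = t \<or> y \<noteq> r \<and> par y \<in> U"
  shows "Digraph_Component.connected (induce_subgraph (with_proj ptree) U)"
proof -
  let ?A = "Restr (parcs ptree) U"
  have to_t: "(y, t) \<in> ?A\<^sup>*" if "y \<in> U" for y
    using that
  proof (induction "rk y" arbitrary: y rule: less_induct)
    case less
    show ?case
    proof (cases "y = t")
      case False
      with assms less.prems have y: "y \<in> N" "y \<noteq> r" "par y \<in> U" by auto
      with less have "(par y, t) \<in> ?A\<^sup>*" using rk_par by simp
      moreover have "(y, par y) \<in> ?A" using y less.prems by (simp add: up_iff)
      ultimately show ?thesis by (rule converse_rtrancl_into_rtrancl[rotated])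
    qed simp
  qed
  have "sym ?A" by (auto simp: sym_def)
  from sym_rtrancl[OF this] have "(t, y) \<in> ?A\<^sup>*" if "y \<in> U" for y
    using to_t[OF that] by (rule symD)
  with to_t have "(x, y) \<in> ?A\<^sup>*" if "x \<in> U" "y \<in> U" for x y
    using that by (meson rtrancl_trans)
  then show ?thesis
    unfolding connected_induce_iff[OF pair_graph_tree] using assms(2) by blast
qed

lemma undirected_tree_tree: "undirected_tree ptree"
proof -
  have "Digraph_Component.connected (with_proj ptree)"
  proof -
    have conn: "Digraph_Component.connected (induce_subgraph (with_proj ptree) N)"
      by (rule connected_subtree[of _ r]) (use root_in par_in in auto)
    have eq: "Restr (parcs ptree) N = parcs ptree" using par_in by (auto simp: up_iff)
    from conn[unfolded connected_induce_iff[OF pair_graph_tree] eq] show ?thesis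
      unfolding connected_iff[OF pair_graph_tree] ptree_simps(1) .
  qed
  \<comment> \<open>Without the arc to its parent, a walk from \<open>x\<close> stays below
    \<open>x\<close>, whereas \<open>par x\<close> has smaller rank. A general \<open>F\<close> lets
    one argument serve both orientations.\<close>
  moreover have bridge: "(x, par x) \<notin> (parcs ptree - F)\<^sup>*"
    if x: "x \<in> N" "x \<noteq> r" and F: "(x, par x) \<in> F" for x F
  proof
    assume "(x, par x) \<in> (parcs ptree - F)\<^sup>*"
    then have "(par x, x) \<in> up\<^sup>*"
    proof (induction rule: rtrancl_induct)
      case (step y z)
      then have "(y, z) \<noteq> (x, par x)" using F by auto
      with step show ?case using subtree_step by blast
    qed simp
    with up_rtrancl_rk rk_par[OF x] show False by (meson not_le)
  qed
  moreover have "(x, y) \<notin> (parcs ptree - {(x, y), (y, x)})\<^sup>*" if "(x, y) \<in> parcs ptree" for x y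
  proof (cases "(x, y) \<in> up")
    case True
    then show ?thesis using bridge[of x "{(x, y), (y, x)}"] by (simp add: up_iff)
  next
    case False
    with that have "(y, x) \<in> up" by simp
    then have "(y, x) \<notin> (parcs ptree - {(x, y), (y, x)})\<^sup>*"
      using bridge[of y "{(x, y), (y, x)}"] by (simp add: up_iff)
    moreover have "sym (parcs ptree - {(x, y), (y, x)})" by (auto simp: sym_def)
    from symD[OF sym_rtrancl[OF this], of x y]
    have "(x, y) \<in> (parcs ptree - {(x, y), (y, x)})\<^sup>* \<Longrightarrow>
      (y, x) \<in> (parcs ptree - {(x, y), (y, x)})\<^sup>*" .
    ultimately show ?thesis by (rule contrapos_nn)
  qed
  ultimately show ?thesis
    unfolding undirected_tree_iff_bridges using pair_graph_tree by blast
qed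

text \<open>If instead \<open>y\<close> were the parent of \<open>x\<close>, the part of the root
  path up to \<open>x\<close> would avoid \<open>y\<close>. Read backwards from \<open>x\<close> it
  could not leave the subtree of \<open>x\<close>, so the root would lie below
  \<open>x\<close>.\<close>

lemma parent_of_tree:
  assumes "parent_of ptree r x y"
  shows "y \<in> N \<and> y \<noteq> r \<and> x = par y"
proof (rule ccontr)
  assume no: "\<not> ?thesis"
  from assms obtain p where p: "(x, y) \<in> parcs ptree" "vpath p (with_proj ptree)"
    "hd p = r" "last p = y" "x \<in> set p"
    unfolding parent_of_def by blast
  with no have x: "x \<in> N" "x \<noteq> r" and y: "y = par x" by (auto simp: up_iff)
  have "x \<noteq> y" using rk_par[OF x] y by auto
  obtain p1 p2 where p12: "p = p1 @ x # p2" using p(5) by (meson split_list)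
  with p(4) \<open>x \<noteq> y\<close> have "p2 \<noteq> []" by auto
  with p(4) p12 have "y \<in> set p2" by (metis last.simps last_append last_in_set list.distinct(1))
  with p(2) p12 \<open>x \<noteq> y\<close> have "y \<notin> set (p1 @ [x])" by (auto simp: vpath_def)
  moreover have "set (vwalk_arcs (p1 @ [x])) \<subseteq> parcs ptree"
    using p(2) set_vwalk_arcs_append1[of "p1 @ [x]" p2] p12 by (auto simp: vpath_def vwalk_def)
  ultimately have "(hd (p1 @ [x]), x) \<in> up\<^sup>*"
  proof (induction p1)
    case (Cons u q)
    then have IH: "(hd (q @ [x]), x) \<in> up\<^sup>*" by (cases q) auto
    from Cons have "(u, hd (q @ [x])) \<in> parcs ptree" by simp
    then have "(hd (q @ [x]), u) \<in> parcs ptree" by auto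
    moreover have "(hd (q @ [x]), u) \<noteq> (x, par x)" using Cons.prems y by auto
    ultimately have "(u, x) \<in> up\<^sup>*" using subtree_step[OF _ IH] by blast
    then show ?case by simp
  qed simp
  moreover have "hd (p1 @ [x]) = r" using p(3) p12 by (cases p1) auto
  ultimately have "(r, x) \<in> up\<^sup>*" by simp
  then show False
    by (rule converse_rtranclE) (use x in \<open>auto simp: up_iff\<close>)
qed

end

section \<open>Translation between the two representations\<close>

lemma tree_decomposition_abstract:
  assumes G: "pair_graph G" and T: "tree_decomposition G T B"
    and width: "decomposition_width T B \<le> int k"
  shows "abstract_tree_decomposition (pverts T) (parcs T) B (pverts G) (parcs G) (k + 1)"
proof -
  interpret G: pair_graph G by fact
  have tree: "undirected_tree T" using T by (simp add: tree_decomposition_def)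
  then interpret T: pair_graph T by (simp add: undirected_tree_def)
  have conn: "pverts T \<noteq> {}" "\<And>x y. x \<in> pverts T \<Longrightarrow> y \<in> pverts T \<Longrightarrow> (x, y) \<in> (parcs T)\<^sup>*"
    using tree connected_iff[OF T.pair_graph] by (auto simp: undirected_tree_def)
  have sub: "B x \<subseteq> pverts G" if "x \<in> pverts T" for x
    using T that by (simp add: tree_decomposition_def)
  have bags: "{x \<in> pverts T. v \<in> B x} \<noteq> {} \<and>
      (\<forall>x\<in>{x \<in> pverts T. v \<in> B x}. \<forall>y\<in>{x \<in> pverts T. v \<in> B x}.
        (x, y) \<in> (Restr (parcs T) {x \<in> pverts T. v \<in> B x})\<^sup>*)" if "v \<in> pverts G" for v
    using T that unfolding connected_induce_iff[OF T.pair_graph, symmetric]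
    by (simp add: tree_decomposition_def)
  show ?thesis
  proof
    show "finite (pverts T)" by (rule T.pair_finite_verts)
    show "parcs T \<subseteq> pverts T \<times> pverts T" using T.in_arcsD1 T.in_arcsD2 by auto
    show "sym (parcs T)" using T.arcs_symmetric by (auto intro: symI)
    show "(x, y) \<notin> (parcs T - {(x, y), (y, x)})\<^sup>*" if "(x, y) \<in> parcs T" for x y
      using tree that by (simp add: undirected_tree_iff_bridges)
    show "finite (B x)" if "x \<in> pverts T" for x
      by (rule finite_subset[OF sub[OF that] G.pair_finite_verts])
    show "card (B x) \<le> k + 1" if "x \<in> pverts T" for x
    proof -
      have "card (B x) \<le> Max ((\<lambda>x. card (B x)) ` pverts T)"
        using that T.pair_finite_verts by (intro Max_ge) auto
      with width show ?thesis by (simp add: decomposition_width_def)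
    qed
    show "\<exists>x\<in>pverts T. v \<in> B x" if "v \<in> pverts G" for v
      using bags[OF that] by auto
    show "(x, y) \<in> (Restr (parcs T) {x \<in> pverts T. v \<in> B x})\<^sup>*"
      if x: "x \<in> pverts T" "y \<in> pverts T" "v \<in> B x" "v \<in> B y" for x y v
    proof -
      have "v \<in> pverts G" using sub x by blast
      from bags[OF this, THEN conjunct2] show ?thesis using x by simp
    qed
    show "\<exists>x\<in>pverts T. v \<in> B x \<and> w \<in> B x" if "(v, w) \<in> parcs G" for v w
      using T that unfolding tree_decomposition_def by fast
  qed (use conn sub in auto)
qed

text \<open>Paths are encoded as naturals by \<open>to_nat\<close> to obtain the node type of the
  theorem; dropping the last entry gives the parent.\<close>

lemma (in slick_list_dec) rooted_slick_decomposition: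
  assumes G: "pair_graph G" and "V = pverts G" "E = parcs G"
  shows "\<exists>(T :: nat pair_pre_digraph) r B.
    rooted_tree_decomposition G T r B \<and> slick G T r B \<and>
    decomposition_width T B \<le> int b - 1 \<and> max_degree T \<le> 6"
proof -
  interpret G: pair_graph G by fact
  define par :: "nat \<Rightarrow> nat" where "par n = to_nat (butlast (from_nat n :: nat list))" for n
  define BB where "BB n = B (from_nat n)" for n :: nat
  have par_snoc [simp]: "par (to_nat (p @ [i])) = to_nat p" for p :: "nat list" and i
    by (simp add: par_def)
  have cases_node: "\<exists>p i. n = to_nat (p @ [i]) \<and> p @ [i] \<in> N"
    if "n \<in> to_nat ` N" "n \<noteq> to_nat ([] :: nat list)" for n
    using that by (metis append_butlast_last_id imageE)
  interpret parent_tree "to_nat ` N" "to_nat ([] :: nat list)" par "\<lambda>n. length (from_nat n :: nat list)"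
  proof
    fix n assume n: "n \<in> to_nat ` N" "n \<noteq> to_nat ([] :: nat list)"
    from cases_node[OF this] obtain p i where pi: "n = to_nat (p @ [i])" "p @ [i] \<in> N" by blast
    show "par n \<in> to_nat ` N" using pi parent_in by auto
    show "length (from_nat (par n) :: nat list) < length (from_nat n :: nat list)"
      by (simp add: pi)
  qed (use finite_nodes root_in in auto)
  have "Digraph_Component.connected
      (induce_subgraph (with_proj ptree) {x \<in> pverts ptree. v \<in> BB x})" if v: "v \<in> pverts G" for v
  proof -
    \<comment> \<open>Every node whose bag contains \<open>v\<close>, except \<open>t\<close>, has a
      parent with the same property, as \<open>connected_subtree\<close> demands.\<close>
    obtain t where t: "t \<in> N" "v \<in> B t"
      "\<And>p i. p @ [i] \<in> N \<Longrightarrow> v \<in> B (p @ [i]) \<Longrightarrow> p @ [i] = t \<or> v \<in> B p"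
      and root: "v \<in> B [] \<longrightarrow> t = []"
      using top_node[of v] v assms(2) by auto
    show ?thesis
    proof (rule connected_subtree[where t = "to_nat t"])
      fix y assume y: "y \<in> {x \<in> pverts ptree. v \<in> BB x}"
      show "y = to_nat t \<or> y \<noteq> to_nat ([] :: nat list) \<and> par y \<in> {x \<in> pverts ptree. v \<in> BB x}"
      proof (cases "y = to_nat ([] :: nat list)")
        case True
        with y root show ?thesis by (simp add: BB_def)
      next
        case False
        with y cases_node[of y] obtain p i where pi: "y = to_nat (p @ [i])" "p @ [i] \<in> N" by auto
        with y t(3)[OF pi(2)] have "p @ [i] = t \<or> v \<in> B p" by (simp add: BB_def)
        with pi parent_in[OF pi(2)] False show ?thesis by (auto simp: BB_def)
      qed
    qed (use t in \<open>auto simp: BB_def\<close>)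
  qed
  moreover have "\<exists>x\<in>pverts ptree. v \<in> BB x \<and> w \<in> BB x" if "(v, w) \<in> parcs G" for v w
    using edge_in_bag[of v w] that G.in_arcsD1[OF that] G.in_arcsD2[OF that] assms
    by (auto simp: BB_def)
  ultimately have "tree_decomposition G ptree BB"
    unfolding tree_decomposition_def
    using undirected_tree_tree bag_subset assms(2) by (auto simp: BB_def)
  then have "rooted_tree_decomposition G ptree (to_nat ([] :: nat list)) BB"
    using root_in by (simp add: rooted_tree_decomposition_def)
  moreover have "slick G ptree (to_nat ([] :: nat list)) BB"
    unfolding slick_def
  proof (intro allI impI ballI)
    fix x y v assume "parent_of ptree (to_nat ([] :: nat list)) x y" and v: "v \<in> BB x \<inter> BB y"
    from parent_of_tree[OF this(1)] cases_node[of y]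
    obtain p i where pi: "y = to_nat (p @ [i])" "p @ [i] \<in> N" "x = to_nat p" by auto
    then show "nbhd G v \<inter> BB y - BB x \<noteq> {}"
      using slick_arc[OF pi(2), of v] v assms(3) by (auto simp: nbhd_def BB_def)
  qed
  moreover have "decomposition_width ptree BB \<le> int b - 1"
  proof -
    have "Max ((\<lambda>x. card (BB x)) ` pverts ptree) \<le> b"
      using finite_nodes root_in card_bag by (subst Max_le_iff) (auto simp: BB_def)
    then show ?thesis by (simp add: decomposition_width_def)
  qed
  moreover have "max_degree ptree \<le> 6"
  proof -
    have "card (nbhd ptree y) \<le> 6" for y
    proof -
      let ?C = "(\<lambda>i. to_nat ((from_nat y :: nat list) @ [i])) ` {..<5}"
      have "x \<in> ?C" if "(x, y) \<in> up" for x
      proof -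
        from that have "x \<in> to_nat ` N" "x \<noteq> to_nat ([] :: nat list)" "y = par x"
          by (auto simp: up_iff)
        with cases_node[of x] obtain p i where "x = to_nat (p @ [i])" "p @ [i] \<in> N" "y = to_nat p"
          by auto
        then show ?thesis using child_less[of p i] by auto
      qed
      \<comment> \<open>Five possible children and one parent account for the 6.\<close>
      then have "nbhd ptree y \<subseteq> insert (par y) ?C"
        by (auto simp: nbhd_def up_iff)
      then have "card (nbhd ptree y) \<le> card (insert (par y) ?C)"
        by (intro card_mono) auto
      also have "\<dots> \<le> Suc (card ?C)" by (rule card_insert_le_m1) simp_all
      also have "\<dots> \<le> 6" using card_image_le[of "{..<5::nat}"] by simp
      finally show ?thesis .
    qed
    then show ?thesis
      unfolding max_degree_def using finite_nodes root_in by (subst Max_le_iff) auto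
  qed
  ultimately show ?thesis by blast
qed

theorem theorem20:
  fixes k :: nat and G :: "'a pair_pre_digraph"
  assumes "pair_graph G" and "treewidth G \<le> int k"
  shows "\<exists>(T :: nat pair_pre_digraph) r B.
           rooted_tree_decomposition G T r B \<and> slick G T r B \<and>
           decomposition_width T B \<le> 14 * int k + 13 \<and>
           max_degree T \<le> 6"
proof -
  interpret pair_graph G by fact
  obtain T :: "nat pair_pre_digraph" and B
    where T: "tree_decomposition G T B" "decomposition_width T B = treewidth G"
    using treewidth_attained[OF assms(1)] .
  interpret D: abstract_tree_decomposition "pverts T" "parcs T" B "pverts G" "parcs G" "k + 1"
    using assms T by (intro tree_decomposition_abstract) auto
  have "sym (parcs G)" using arcs_symmetric by (auto intro: symI)
  \<comment> \<open>The recursion starts with \<open>S\<close> empty and \<open>K = k + 1\<close>;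
    bags of size \<open>14 * (k + 1)\<close> mean width \<open>14 * k + 13\<close>.\<close>
  then obtain N B' where "slick_list_dec (parcs G) (14 * (k + 1)) (pverts G) {} N B'"
    using D.slick_list_dec_exists[OF pair_finite_verts, of "pverts G" "{}"] by auto
  from slick_list_dec.rooted_slick_decomposition[OF this assms(1) refl refl]
  show ?thesis by (simp add: algebra_simps)
qed

end
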